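(* Let $f$ be a relation on a uniform space $(X,\mathcal U)$ and let $x,y\in X$. Then $(x,y)\in\mathcal A_{\mathcal U}f$ if and only if for every sequence $\xi=\{U_k:k\in\mathbb N\}$ of elements of $\mathcal U$ there is a $\xi$ sequence chain for $f$ from $x$ to $y$.
   Context: A relation on $X$ is a subset $f\subset X\times X$. The gage $\Gamma(\mathcal U)$ is the set of all bounded pseudo-metrics $d$ on $X$ with $\{(x,y):d(x,y)<\epsilon\}\in\mathcal U$ for every $\epsilon>0$. $\mathcal A_{\mathcal U}f$ is the set of pairs $(x,y)$ such that for every $d\in\Gamma(\mathcal U)$ and $\epsilon>0$ there are $n\ge1$ and $(a_1,b_1),\dots,(a_n,b_n)\in f$ with $d(x,a_1)+\sum_{i=1}^{n-1}d(b_i,a_{i+1})+d(b_n,y)<\epsilon$. Here $\mathbb N=\{1,2,\dots\}$. Given $\xi=\{U_k:k\in\mathbb N\}$ in $\mathcal U$, a $\xi$ sequence chain for $f$ from $x$ to $y$ is a finite sequence $(a_1,b_1),\dots,(a_n,b_n)\in f$ with $n\ge1$ for which there is an injective map $\sigma:\{0,\dots,n\}\to\mathbb N$ such that $(b_i,a_{i+1})\in U_{\sigma(i)}$ for $i=0,\dots,n$, where $b_0=x$ and $a_{n+1}=y$. *)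

theory Defs
  imports Complex_Main
begin

text \<open>
  The uniform space is the whole type of class \<^class>\<open>uniform_space\<close>. The library
  represents the uniformity as a filter on pairs; its elements are the sets whose
  membership predicate holds eventually along that filter. No separation axiom is assumed.
\<close>

definition entourages :: "('a::uniform_space \<times> 'a) set set" where
  "entourages = {U. eventually (\<lambda>p. p \<in> U) uniformity}"

definition pseudo_metric :: "('a \<Rightarrow> 'a \<Rightarrow> real) \<Rightarrow> bool" where
  "pseudo_metric d \<longleftrightarrow>
     (\<forall>x y. 0 \<le> d x y) \<and> (\<forall>x. d x x = 0) \<and> (\<forall>x y. d x y = d y x) \<and>
     (\<forall>x y z. d x z \<le> d x y + d y z)"

definition gage :: "('a::uniform_space \<Rightarrow> 'a \<Rightarrow> real) set" where
  "gage = {d. pseudo_metric d \<and> (\<exists>B. \<forall>x y. d x y \<le> B) \<and>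
              (\<forall>\<epsilon>>0. {(x, y). d x y < \<epsilon>} \<in> entourages)}"

text \<open>
  In the next two definitions a finite sequence \<open>(a\<^sub>1, b\<^sub>1), \<dots>, (a\<^sub>n, b\<^sub>n)\<close> is given by two
  functions on \<^typ>\<open>nat\<close>, of which only the values at the indices \<open>1, \<dots>, n\<close> matter
  (apart from the conventions \<open>b\<^sub>0 = x\<close> and \<open>a\<^sub>n\<^sub>+\<^sub>1 = y\<close> in the second one).
\<close>

definition Aubry_rel :: "('a::uniform_space \<times> 'a) set \<Rightarrow> ('a \<times> 'a) set" where
  "Aubry_rel f =
     {(x, y). \<forall>d\<in>gage. \<forall>\<epsilon>>0. \<exists>(n::nat)\<ge>1. \<exists>a b. (\<forall>i\<in>{1..n}. (a i, b i) \<in> f) \<and>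
        d x (a 1) + (\<Sum>i=1..n-1. d (b i) (a (i + 1))) + d (b n) y < \<epsilon>}"

text \<open>Here \<open>U\<close> is indexed by the positive integers, so the value \<open>U 0\<close> is irrelevant.\<close>

definition sequence_chain ::
    "(nat \<Rightarrow> ('a \<times> 'a) set) \<Rightarrow> ('a \<times> 'a) set \<Rightarrow> 'a \<Rightarrow> 'a \<Rightarrow>
     nat \<Rightarrow> (nat \<Rightarrow> 'a) \<Rightarrow> (nat \<Rightarrow> 'a) \<Rightarrow> bool" where
  "sequence_chain U f x y n a b \<longleftrightarrow>
     n \<ge> 1 \<and> (\<forall>i\<in>{1..n}. (a i, b i) \<in> f) \<and> b 0 = x \<and> a (n + 1) = y \<and>
     (\<exists>\<sigma>. \<sigma> ` {0..n} \<subseteq> {1..} \<and> inj_on \<sigma> {0..n} \<and>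
          (\<forall>i\<in>{0..n}. (b i, a (i + 1)) \<in> U (\<sigma> i)))"

end

theory Submission
  imports Defs
begin

text \<open>
  Listing the gaps \<open>d(b\<^sub>i, a\<^sub>i\<^sub>+\<^sub>1)\<close> of a chain in decreasing order, the \<open>j\<close>-th one is at most
  \<open>1/j\<close> times their sum. So a chain with gap sum at most \<open>1/2\<close> is a sequence chain for \<open>\<xi>\<close>, with
  \<open>\<sigma>\<close> the rank, as soon as \<open>d(p,q) < 1/(2j)\<close> implies \<open>(p,q) \<in> U\<^sub>j\<close> for all \<open>j\<close>; such a \<open>d\<close>
  comes from the metrization lemma for countably many entourages. Conversely, the sequence
  \<open>U\<^sub>k = {d < \<epsilon>/2\<^sup>k}\<close> turns distinct indices into a gap sum below \<open>\<epsilon>\<close>.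
\<close>

section \<open>Closure properties and cube roots of entourages\<close>

text \<open>Three factors, because a path will later be cut into a first piece, a middle edge and a
  last piece.\<close>

lemma entourage_cube_root:
  assumes "E \<in> entourages"
  obtains D where "D \<in> entourages" "sym D" "D O D O D \<subseteq> E"
proof -
  have E: "eventually (\<lambda>p. p \<in> E) uniformity"
    using assms by (simp add: entourages_def)
  from uniformity_trans[OF E] obtain D1 where D1: "eventually D1 uniformity"
    "\<And>x y z. D1 (x, y) \<Longrightarrow> D1 (y, z) \<Longrightarrow> (x, z) \<in> E" by auto
  from uniformity_trans[OF D1(1)] obtain D2 where D2: "eventually D2 uniformity"
    "\<And>x y z. D2 (x, y) \<Longrightarrow> D2 (y, z) \<Longrightarrow> D1 (x, z)" by auto
  define D where "D = {(x, y). D2 (x, y) \<and> D2 (y, x)}"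
  have "eventually (\<lambda>(x, y). D2 (y, x)) uniformity"
    using uniformity_sym[OF D2(1)] .
  with D2(1) have "D \<in> entourages"
    unfolding entourages_def D_def by (auto elim: eventually_elim2)
  moreover have "sym D" by (auto simp: D_def sym_def)
  moreover have "D O D O D \<subseteq> E"
  proof clarify
    fix x y z w assume *: "(x, y) \<in> D" "(y, z) \<in> D" "(z, w) \<in> D"
    \<comment> \<open>The trivial step at \<open>w\<close> lifts \<open>(z, w)\<close> from
      \<open>D2\<close> to \<open>D1\<close>, to match \<open>D1 (x, z)\<close>.\<close>
    have "D2 (w, w)" using uniformity_refl[OF D2(1)] .
    with * show "(x, w) \<in> E"
      using D1(2)[of x z w] D2(2)[of x y z] D2(2)[of z w w] by (auto simp: D_def)
  qed
  ultimately show ?thesis by (rule that)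
qed

lemma Id_in_entourage: "E \<in> entourages \<Longrightarrow> (x, x) \<in> E"
  unfolding entourages_def using uniformity_refl by fastforce

lemma entourages_Int: "A \<in> entourages \<Longrightarrow> B \<in> entourages \<Longrightarrow> A \<inter> B \<in> entourages"
  unfolding entourages_def by (auto intro: eventually_conj)

lemma entourages_mono: "A \<in> entourages \<Longrightarrow> A \<subseteq> B \<Longrightarrow> B \<in> entourages"
  unfolding entourages_def by (auto elim: eventually_mono)

lemma UNIV_entourage: "UNIV \<in> entourages"
  unfolding entourages_def by simp

section \<open>Weighted paths along a sequence of relations\<close>

text \<open>An edge may use any label \<open>k\<close> whose \<open>V k\<close> contains it, at cost
  \<open>(1/2)^k\<close>; \<open>n\<close> counts the edges for a later induction.\<close>

inductive weighted_path :: "(nat \<Rightarrow> ('a \<times> 'a) set) \<Rightarrow> nat \<Rightarrow> 'a \<Rightarrow> 'a \<Rightarrow> real \<Rightarrow> bool"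
  for V where
  refl: "weighted_path V 0 x x 0"
| step: "weighted_path V n x y s \<Longrightarrow> (y, z) \<in> V k \<Longrightarrow> weighted_path V (Suc n) x z (s + (1/2)^k)"

lemma weighted_path_nonneg: "weighted_path V n x y s \<Longrightarrow> 0 \<le> s"
  by (induction rule: weighted_path.induct) auto

lemma weighted_path_edge: "(x, y) \<in> V k \<Longrightarrow> weighted_path V 1 x y ((1/2)^k)"
  using weighted_path.step[OF weighted_path.refl] by fastforce

lemma weighted_path_trans:
  assumes "weighted_path V m y z t" "weighted_path V n x y s"
  shows "weighted_path V (n + m) x z (s + t)"
  using assms
  by (induction rule: weighted_path.induct)
     (auto simp flip: add.assoc intro: weighted_path.step)

lemma weighted_path_sym:
  assumes "weighted_path V n x y s" "\<And>k. sym (V k)"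
  shows "weighted_path V n y x s"
  using assms(1)
proof (induction rule: weighted_path.induct)
  case (step n x y s z k)
  then have "weighted_path V 1 z y ((1/2)^k)"
    using assms(2) by (intro weighted_path_edge) (auto dest: symD)
  from weighted_path_trans[OF step.IH this] show ?case by (simp add: add.commute)
qed (rule weighted_path.refl)

text \<open>Cut at the last edge before which the running weight is still at most \<open>t\<close>;
  including that edge, the running weight is at least \<open>t\<close>.\<close>

lemma weighted_path_split:
  assumes "weighted_path V n x z s" "n > 0" "0 \<le> t" "t \<le> s"
  shows "\<exists>n1 n2 p q k s1 s2. weighted_path V n1 x p s1 \<and> (p, q) \<in> V k \<and>
    weighted_path V n2 q z s2 \<and> n = n1 + n2 + 1 \<and> s = s1 + (1/2)^k + s2 \<and> s1 \<le> t \<and> s2 \<le> s - t"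
  using assms
proof (induction rule: weighted_path.induct)
  case (refl x)
  then show ?case by simp
next
  case (step n x y s z k)
  show ?case
  proof (cases "s \<le> t")
    case True
    then show ?thesis
      using step.hyps step.prems weighted_path.refl[of V z]
      by (intro exI[of _ n] exI[of _ 0] exI[of _ y] exI[of _ z] exI[of _ k] exI[of _ s] exI[of _ 0]) auto
  next
    case False
    have "n > 0"
      using step.hyps(1) False \<open>0 \<le> t\<close> by (cases rule: weighted_path.cases) auto
    with step.IH \<open>0 \<le> t\<close> False obtain n1 n2 p q k' s1 s2 where
      *: "weighted_path V n1 x p s1" "(p, q) \<in> V k'" "weighted_path V n2 q y s2"
        "n = n1 + n2 + 1" "s = s1 + (1/2)^k' + s2" "s1 \<le> t" "s2 \<le> s - t"
      by (metis linear)
    have "weighted_path V (Suc n2) q z (s2 + (1/2)^k)"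
      using weighted_path.step[OF *(3) step.hyps(2)] .
    with * show ?thesis
      by (intro exI[of _ n1] exI[of _ "Suc n2"] exI[of _ p] exI[of _ q] exI[of _ k']
            exI[of _ s1] exI[of _ "s2 + (1/2)^k"]) auto
  qed
qed

text \<open>Cut a path at half its weight. Both outer pieces weigh less than
  \<open>(1/2)^Suc k\<close> and have fewer edges, so induction puts them in
  \<open>V (Suc k)\<close>; the middle edge belongs there too, and the triple composition lands in
  \<open>V k\<close>.\<close>

lemma weighted_path_short_imp:
  assumes V: "\<And>k. V (Suc k) O V (Suc k) O V (Suc k) \<subseteq> V k" and Id: "\<And>k x. (x, x) \<in> V k"
    and "weighted_path V n x y s" "s < (1/2)^k"
  shows "(x, y) \<in> V k"
  using assms(3,4)
proof (induction n arbitrary: x y s k rule: less_induct)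
  case (less n)
  have V': "(x, w) \<in> V k" if "(x, y) \<in> V (Suc k)" "(y, z) \<in> V (Suc k)" "(z, w) \<in> V (Suc k)"
    for x y z w k
    using that V by (meson relcompI subsetD)
  \<comment> \<open>Diagonal pairs in two of the three factors give
    \<open>V (Suc k) \<subseteq> V k\<close>.\<close>
  have "antimono V"
    using V'[OF Id Id] by (intro decseq_SucI subrelI)
  show ?case
  proof (cases "n = 0")
    case True
    with less.prems(1) show ?thesis by (cases rule: weighted_path.cases) (auto simp: Id)
  next
    case False
    have "0 \<le> s" using weighted_path_nonneg[OF less.prems(1)] .
    then have "n > 0" "0 \<le> s/2" "s/2 \<le> s" using False by auto
    from weighted_path_split[OF less.prems(1) this] obtain n1 n2 p q m s1 s2 where
      *: "weighted_path V n1 x p s1" "(p, q) \<in> V m" "weighted_path V n2 q y s2"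
        "n = n1 + n2 + 1" "s = s1 + (1/2)^m + s2" "s1 \<le> s/2" "s2 \<le> s - s/2"
      by blast
    have "s1 < (1/2)^Suc k" "s2 < (1/2)^Suc k"
      using *(6,7) less.prems(2) unfolding power_Suc by linarith+
    then have "(x, p) \<in> V (Suc k)" "(q, y) \<in> V (Suc k)"
      using less.IH[OF _ *(1)] less.IH[OF _ *(3)] *(4) by simp_all
    moreover have "(p, q) \<in> V (Suc k)"
    proof -
      \<comment> \<open>A single edge costs at most the whole path, so the strict bound forces its
        label \<open>m\<close> to be at least \<open>Suc k\<close>.\<close>
      have "(1/2::real)^m < (1/2)^k"
        using weighted_path_nonneg[OF *(1)] weighted_path_nonneg[OF *(3)] *(5) less.prems(2)
        by linarith
      then have "k < m" by (simp add: power_strict_decreasing_iff)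
      with antimonoD[OF \<open>antimono V\<close>, of "Suc k" m] *(2) show ?thesis by auto
    qed
    ultimately show ?thesis using V'[of x p k q y] by blast
  qed
qed

section \<open>Path pseudo-metrics and the metrization lemma\<close>

definition path_dist :: "(nat \<Rightarrow> ('a \<times> 'a) set) \<Rightarrow> 'a \<Rightarrow> 'a \<Rightarrow> real" where
  "path_dist V x y = Inf {s. \<exists>n. weighted_path V n x y s}"

lemma path_dist_le: "weighted_path V n x y s \<Longrightarrow> path_dist V x y \<le> s"
  unfolding path_dist_def
  by (rule cInf_lower) (auto intro: bdd_belowI[of _ 0] weighted_path_nonneg)

text \<open>With \<open>V 0 = UNIV\<close> every pair is an edge of weight 1, so the infimum runs
  over a nonempty set.\<close>

lemma path_dist_lessE:
  assumes "V 0 = UNIV" "path_dist V x y < e"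
  obtains n s where "weighted_path V n x y s" "s < e"
proof -
  have "{s. \<exists>n. weighted_path V n x y s} \<noteq> {}"
    using weighted_path_edge[of x y V 0] assms(1) by auto
  from cInf_lessD[OF this] assms(2) show ?thesis
    unfolding path_dist_def by (auto intro: that)
qed

lemma pseudo_metric_path_dist:
  assumes "V 0 = UNIV" "\<And>k. sym (V k)"
  shows "pseudo_metric (path_dist V)"
  unfolding pseudo_metric_def
proof (intro conjI allI)
  show ge0: "0 \<le> path_dist V x y" for x y
    using path_dist_lessE[of V, OF assms(1)] weighted_path_nonneg by (metis not_le)
  show "path_dist V x x = 0" for x
    using ge0 path_dist_le[OF weighted_path.refl] by (metis order.antisym)
  show "path_dist V x y = path_dist V y x" for x y
    \<comment> \<open>Reversing paths shows that both infima are over the same set of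
      weights.\<close>
    unfolding path_dist_def
    by (intro arg_cong[where f = Inf] Collect_cong iff_exI iffI; erule weighted_path_sym; rule assms(2))
  show "path_dist V x z \<le> path_dist V x y + path_dist V y z" for x y z
  proof (rule field_le_epsilon)
    fix e :: real assume "e > 0"
    then obtain n s where 1: "weighted_path V n x y s" "s < path_dist V x y + e/2"
      using path_dist_lessE[of V x y "path_dist V x y + e/2", OF assms(1)] by auto
    from \<open>e > 0\<close> obtain m t where 2: "weighted_path V m y z t" "t < path_dist V y z + e/2"
      using path_dist_lessE[of V y z "path_dist V y z + e/2", OF assms(1)] by auto
    show "path_dist V x z \<le> path_dist V x y + path_dist V y z + e"
      using path_dist_le[OF weighted_path_trans[OF 2(1) 1(1)]] 1(2) 2(2) by linarith
  qed
qed

text \<open>The metrization lemma, with \<open>path_dist\<close> of a sequence of symmetric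
  entourages as \<open>d\<close>. \<open>W n\<close> is absorbed in \<open>V (Suc n)\<close>, which
  leaves \<open>V 0\<close> free to be \<open>UNIV\<close> and accounts for the exponent
  \<open>Suc k\<close>.\<close>

lemma gage_refining_sequence:
  fixes W :: "nat \<Rightarrow> ('a::uniform_space \<times> 'a) set"
  assumes W: "\<And>k. W k \<in> entourages"
  obtains d where "d \<in> gage" "\<And>k x y. d x y < (1/2)^Suc k \<Longrightarrow> (x, y) \<in> W k"
proof -
  have "\<exists>V. \<forall>n. (V n \<in> entourages \<and> sym (V n) \<and> (n = 0 \<longrightarrow> V n = UNIV)) \<and>
          (V (Suc n) O V (Suc n) O V (Suc n) \<subseteq> V n \<inter> W n)"
  proof (rule dependent_nat_choice)
    fix D :: "('a \<times> 'a) set" and n :: nat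
    assume "D \<in> entourages \<and> sym D \<and> (n = 0 \<longrightarrow> D = UNIV)"
    then have "D \<inter> W n \<in> entourages" using W entourages_Int by blast
    then show "\<exists>E. (E \<in> entourages \<and> sym E \<and> (Suc n = 0 \<longrightarrow> E = UNIV)) \<and> E O E O E \<subseteq> D \<inter> W n"
      using entourage_cube_root by blast
  qed (auto intro!: exI[of _ UNIV] UNIV_entourage symI)
  then obtain V where V: "\<And>n. V n \<in> entourages" "\<And>n. sym (V n)" "V 0 = UNIV"
    "\<And>n. V (Suc n) O V (Suc n) O V (Suc n) \<subseteq> V n \<inter> W n" by metis
  have Id: "(x, x) \<in> V n" for n x using V(1) Id_in_entourage by blast
  show ?thesis
  proof
    have "path_dist V x y \<le> 1" for x y
      using path_dist_le[OF weighted_path_edge[of x y V 0]] V(3) by simp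
    moreover have "{(x, y). path_dist V x y < e} \<in> entourages" if e: "e > 0" for e
    proof -
      obtain k where k: "(1/2::real)^k < e"
        using real_arch_pow_inv[OF e, of "1/2"] by auto
      \<comment> \<open>An edge of label \<open>k\<close> is itself a path of weight
        \<open>(1/2)^k\<close>.\<close>
      have "V k \<subseteq> {(x, y). path_dist V x y < e}"
        using path_dist_le[OF weighted_path_edge[of _ _ V k]] k by fastforce
      with V(1) show ?thesis by (rule entourages_mono)
    qed
    ultimately show "path_dist V \<in> gage"
      unfolding gage_def using pseudo_metric_path_dist[of V] V(2,3) by blast
    show "(x, y) \<in> W k" if d: "path_dist V x y < (1/2)^Suc k" for x y k
    proof -
      have "V (Suc n) O V (Suc n) O V (Suc n) \<subseteq> V n" for n using V(4)[of n] by blast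
      note short = weighted_path_short_imp[of V, OF this Id]
      obtain n s where "weighted_path V n x y s" "s < (1/2)^Suc k"
        using path_dist_lessE[of V, OF V(3) d] .
      then have "(x, y) \<in> V (Suc k)"
        by (rule short)
      \<comment> \<open>Padding with diagonal pairs puts \<open>V (Suc k)\<close> inside
        \<open>W k\<close>.\<close>
      then show ?thesis using V(4)[of k] Id by blast
    qed
  qed
qed

text \<open>Indices are grouped in dyadic blocks: \<open>W k\<close> handles all positive
  \<open>j < 2^Suc k\<close> at once, and for \<open>2^k \<le> j\<close> a distance below
  \<open>1/(2j)\<close> is below \<open>(1/2)^Suc k\<close>. The bound is a product in order to
  match the ranking estimate.\<close>

lemma gage_inverse_index:
  fixes U :: "nat \<Rightarrow> ('a::uniform_space \<times> 'a) set"
  assumes U: "\<And>k. k \<ge> 1 \<Longrightarrow> U k \<in> entourages"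
  obtains d where "d \<in> gage" "\<And>j x y. j \<ge> 1 \<Longrightarrow> real j * d x y < 1/2 \<Longrightarrow> (x, y) \<in> U j"
proof -
  define W where "W k = (\<Inter>j\<in>{1..<2^Suc k}. U j)" for k :: nat
  have fin: "(\<Inter>j\<in>J. U j) \<in> entourages" if "finite J" "J \<subseteq> {1..}" for J
    using that by (induction rule: finite_induct) (auto intro!: UNIV_entourage entourages_Int U)
  have "W k \<in> entourages" for k
    unfolding W_def by (rule fin) auto
  from gage_refining_sequence[of W, OF this] obtain d where d: "d \<in> gage" "\<And>k x y. d x y < (1/2)^Suc k \<Longrightarrow> (x, y) \<in> W k"
    by blast
  show ?thesis
  proof
    fix j x y assume j: "j \<ge> (1::nat)" "real j * d x y < 1/2"
    obtain k where k: "2^k \<le> j" "j < 2^Suc k"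
      using ex_power_ivl1[of 2 j] j(1) by auto
    have "0 \<le> d x y" using d(1) by (auto simp: gage_def pseudo_metric_def)
    moreover have "2^k \<le> real j"
      using k(1) by (metis of_nat_le_iff of_nat_numeral of_nat_power)
    ultimately have "2^k * d x y \<le> real j * d x y" by (intro mult_right_mono)
    then have "2^k * d x y < 1/2" using j(2) by linarith
    then have "d x y < (1/2)^Suc k" by (simp add: field_simps)
    from d(2)[OF this] show "(x, y) \<in> U j" using j(1) k by (auto simp: W_def)
  qed (rule d)
qed

section \<open>Ranking of reals and finite sums\<close>

text \<open>Rank by decreasing value: the values of ranks \<open>1\<close> to
  \<open>\<sigma> i\<close> are each at least \<open>g i\<close>, and the remaining ones are
  nonnegative.\<close>

lemma rank_times_value_le_sum:
  fixes g :: "'i \<Rightarrow> real"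
  assumes "finite I" "\<And>i. i \<in> I \<Longrightarrow> 0 \<le> g i"
  shows "\<exists>\<sigma>. bij_betw \<sigma> I {1..card I} \<and> (\<forall>i\<in>I. real (\<sigma> i) * g i \<le> sum g I)"
  using assms
\<comment> \<open>The sign makes each new element one with the smallest \<open>g\<close>, so it
  takes the next free rank.\<close>
proof (induction rule: finite_ranking_induct[where f = "\<lambda>i. - g i"])
  case empty
  then show ?case by (auto simp: bij_betw_def)
next
  case (insert x S)
  then obtain \<sigma> where \<sigma>: "bij_betw \<sigma> S {1..card S}" "\<forall>i\<in>S. real (\<sigma> i) * g i \<le> sum g S"
    by auto
  show ?case
  \<comment> \<open>The induction rule allows \<open>x\<close> to lie in \<open>S\<close>
    already.\<close>
  proof (cases "x \<in> S")
    case True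
    with \<sigma> show ?thesis by (auto simp: insert_absorb)
  next
    case False
    define \<tau> where "\<tau> = \<sigma>(x := Suc (card S))"
    have "bij_betw \<tau> S {1..card S}"
      using \<sigma>(1) False by (subst bij_betw_cong[of S \<tau> \<sigma>]) (auto simp: \<tau>_def)
    then have "bij_betw \<tau> (S \<union> {x}) ({1..card S} \<union> {\<tau> x})"
      using False by (intro notIn_Un_bij_betw) (auto simp: \<tau>_def)
    moreover have "{1..card S} \<union> {\<tau> x} = {1..card (insert x S)}"
      using insert.hyps(1) False by (auto simp: \<tau>_def)
    ultimately have "bij_betw \<tau> (insert x S) {1..card (insert x S)}" by simp
    moreover have "real (\<tau> i) * g i \<le> sum g (insert x S)" if "i \<in> insert x S" for i
    proof (cases "i = x")
      case True
      have "real (card S) * g x \<le> sum g S"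
        using insert.hyps(2) by (intro sum_bounded_below) auto
      then show ?thesis
        using True False insert.hyps(1) by (simp add: \<tau>_def algebra_simps)
    next
      case i: False
      with that \<sigma>(2) have "real (\<tau> i) * g i \<le> sum g S" by (auto simp: \<tau>_def)
      then show ?thesis using insert.hyps(1) False insert.prems[of x] by simp
    qed
    ultimately show ?thesis by blast
  qed
qed

text \<open>Reconciles the separate end terms in \<open>Aubry_rel\<close> with the uniform index
  range of \<open>sequence_chain\<close>; for \<open>n = 1\<close> the middle sum is empty.\<close>

lemma sum_split_ends:
  fixes g :: "nat \<Rightarrow> 'b::comm_monoid_add"
  assumes "n \<ge> 1"
  shows "(\<Sum>i=0..n. g i) = g 0 + (\<Sum>i=1..n-1. g i) + g n"
  using assms by (cases n) (auto simp: sum.atLeast_Suc_atMost)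

lemma sum_half_powers_less_1:
  assumes "finite K" "K \<subseteq> {1..}"
  shows "(\<Sum>k\<in>K. (1/2::real)^k) < 1"
proof -
  \<comment> \<open>Inserting \<open>0\<close> keeps \<open>Max\<close> meaningful for empty
    \<open>K\<close>.\<close>
  define N where "N = Max (insert 0 K)"
  have "K \<subseteq> {Suc 0..N}" using assms by (auto simp: N_def)
  then have "(\<Sum>k\<in>K. (1/2::real)^k) \<le> (\<Sum>k=Suc 0..N. (1/2)^k)"
    by (intro sum_mono2) auto
  also have "\<dots> = 1 - (1/2)^N"
    by (induction N) (auto simp: field_simps)
  also have "\<dots> < 1" by simp
  finally show ?thesis .
qed

section \<open>The Aubry relation in terms of sequence chains\<close>

theorem theorem5p1:
  fixes f :: "('a::uniform_space \<times> 'a) set" and x y :: 'a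
  shows "(x, y) \<in> Aubry_rel f \<longleftrightarrow>
    (\<forall>U :: nat \<Rightarrow> ('a \<times> 'a) set. (\<forall>k\<ge>1. U k \<in> entourages) \<longrightarrow>
       (\<exists>n a b. sequence_chain U f x y n a b))"
proof (intro iffI allI impI)
  fix U :: "nat \<Rightarrow> ('a \<times> 'a) set"
  assume A: "(x, y) \<in> Aubry_rel f" and U: "\<forall>k\<ge>1. U k \<in> entourages"
  obtain d where d: "d \<in> gage" "\<And>j x y. j \<ge> 1 \<Longrightarrow> real j * d x y < 1/2 \<Longrightarrow> (x, y) \<in> U j"
    using gage_inverse_index U by blast
  have "\<exists>n::nat\<ge>1. \<exists>a b. (\<forall>i\<in>{1..n}. (a i, b i) \<in> f) \<and>
      d x (a 1) + (\<Sum>i=1..n-1. d (b i) (a (i + 1))) + d (b n) y < 1/2"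
    using A[unfolded Aubry_rel_def mem_Collect_eq case_prod_conv, rule_format,
        OF d(1) half_gt_zero[OF zero_less_one]] .
  then obtain n :: nat and a b where n: "n \<ge> 1" and f: "\<forall>i\<in>{1..n}. (a i, b i) \<in> f"
    and lt: "d x (a 1) + (\<Sum>i=1..n-1. d (b i) (a (i + 1))) + d (b n) y < 1/2"
    by blast
  \<comment> \<open>\<open>Aubry_rel\<close> leaves \<open>a (n + 1)\<close> and \<open>b 0\<close>
    arbitrary; overwriting them does not touch the pairs with indices \<open>1\<close> to
    \<open>n\<close>.\<close>
  define a' b' where "a' = a(n + 1 := y)" and "b' = b(0 := x)"
  define g where "g i = d (b' i) (a' (i + 1))" for i
  have "(\<Sum>i=1..n-1. g i) = (\<Sum>i=1..n-1. d (b i) (a (i + 1)))"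
    by (intro sum.cong) (auto simp: g_def a'_def b'_def)
  with lt n have "(\<Sum>i=0..n. g i) < 1/2"
    unfolding sum_split_ends[OF n] by (simp add: g_def a'_def b'_def)
  moreover obtain \<sigma> where \<sigma>: "bij_betw \<sigma> {0..n} {1..card {0..n}}"
    "\<forall>i\<in>{0..n}. real (\<sigma> i) * g i \<le> (\<Sum>i=0..n. g i)"
    using rank_times_value_le_sum[of "{0..n}" g] d(1)
    by (auto simp: g_def gage_def pseudo_metric_def)
  moreover have \<sigma>1: "\<sigma> i \<ge> 1" if "i \<in> {0..n}" for i
    using bij_betwE[OF \<sigma>(1)] that by auto
  \<comment> \<open>Rank times gap is at most the total gap, hence below \<open>1/2\<close>, which
    is the premise of \<open>d(2)\<close>.\<close>
  ultimately have "(b' i, a' (i + 1)) \<in> U (\<sigma> i)" if "i \<in> {0..n}" for i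
    using that by (intro d(2)) (force simp: g_def)+
  then have "\<exists>\<sigma>. \<sigma> ` {0..n} \<subseteq> {1..} \<and> inj_on \<sigma> {0..n} \<and>
      (\<forall>i\<in>{0..n}. (b' i, a' (i + 1)) \<in> U (\<sigma> i))"
    using \<sigma>1 bij_betw_imp_inj_on[OF \<sigma>(1)] by (intro exI[of _ \<sigma>]) auto
  moreover have "\<forall>i\<in>{1..n}. (a' i, b' i) \<in> f" "b' 0 = x" "a' (n + 1) = y"
    using f by (auto simp: a'_def b'_def)
  ultimately have "sequence_chain U f x y n a' b'"
    unfolding sequence_chain_def using n by blast
  then show "\<exists>n a b. sequence_chain U f x y n a b" by blast
next
  assume R: "\<forall>U. (\<forall>k\<ge>1. U k \<in> entourages) \<longrightarrow> (\<exists>n a b. sequence_chain U f x y n a b)"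
  have "\<exists>n::nat\<ge>1. \<exists>a b. (\<forall>i\<in>{1..n}. (a i, b i) \<in> f) \<and>
      d x (a 1) + (\<Sum>i=1..n-1. d (b i) (a (i + 1))) + d (b n) y < e"
    if "d \<in> gage" "e > 0" for d e
  proof -
    define U where "U k = {(p, q). d p q < e * (1/2)^k}" for k :: nat
    have "\<forall>k\<ge>1. U k \<in> entourages"
      using that unfolding U_def gage_def by simp
    with R obtain n a b where "sequence_chain U f x y n a b" by blast
    then obtain \<sigma> where n: "n \<ge> 1" and f: "\<forall>i\<in>{1..n}. (a i, b i) \<in> f"
      and ends: "b 0 = x" "a (n + 1) = y"
      and \<sigma>: "\<sigma> ` {0..n} \<subseteq> {1..}" "inj_on \<sigma> {0..n}"
      and in_U: "\<forall>i\<in>{0..n}. (b i, a (i + 1)) \<in> U (\<sigma> i)"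
      unfolding sequence_chain_def by auto
    have "(\<Sum>i=0..n. d (b i) (a (i + 1))) \<le> (\<Sum>i=0..n. e * (1/2)^\<sigma> i)"
      using in_U by (intro sum_mono) (force simp: U_def)
    \<comment> \<open>Injectivity of \<open>\<sigma>\<close> turns this into a sum over a set of
      exponents, each used once.\<close>
    also have "\<dots> = e * (\<Sum>k\<in>\<sigma> ` {0..n}. (1/2)^k)"
      using \<sigma>(2) by (simp add: sum.reindex sum_distrib_left)
    also have "\<dots> < e"
      using sum_half_powers_less_1[of "\<sigma> ` {0..n}"] \<sigma>(1) \<open>e > 0\<close> by simp
    finally show ?thesis
      using n f ends unfolding sum_split_ends[OF n] by auto
  qed
  then show "(x, y) \<in> Aubry_rel f"
    unfolding Aubry_rel_def by blast
qed

end
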